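(* Let $w>0$ be known and let $u_0,l_0\in\mathbb{R}$ with $u_0-w<l_0$. Let $X=(x_1,\dots,x_n)$ be real observations that are i.i.d. given $l\in\mathbb{R}$, each uniformly distributed on $(l,l+w)$. Suppose $l$ has prior distribution $U(u_0-w,\ l_0)$. Put $u_n=\max(u_0,\max_i x_i)$ and $l_n=\min(l_0,\min_i x_i)$, and assume $u_n-w<l_n$. Then $p(X)=w^{-n}\,\frac{l_n-u_n+w}{l_0-u_0+w}$, the posterior distribution of $l$ given $X$ is $$p(l\mid X)=\frac{1}{l_n-u_n+w}=U(l\mid u_n-w,\ l_n)\qquad(u_n-w<l<l_n),$$ so the uniform prior is conjugate, and the predictive density of a new observation $x$ is $$p(x\mid X)=\begin{cases}\dfrac{l_n-x+w}{w(l_n-u_n+w)}, & \max(l_n,u_n)<x<l_n+w,\\[2mm] \dfrac{l_n-u_n}{w(l_n-u_n+w)}, & l_n<x<u_n,\\[2mm] \dfrac{x-u_n+w}{w(l_n-u_n+w)}, & u_n-w<x<\min(l_n,u_n).\end{cases}$$ This predictive distribution has a trapezoidal shape and has a support wider than that of the empirical distribution $U(l_n,u_n)$. A non-informative improper prior is obtained by letting $l_0\to-\infty$, $u_0\to\infty$.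
   Context: $U(a,b)$ denotes the uniform distribution on $(a,b)$, with density $U(y\mid a,b)=\frac1{b-a}$ for $a<y<b$ and $0$ otherwise. With $p(X\mid l)=\prod_i p(x_i\mid l)$, we write $p(X)=\int p(X\mid l)p(l)\,dl$, and the posterior density is $p(l\mid X)=p(X\mid l)p(l)/p(X)$. The predictive density is $p(x\mid X)=\int p(x\mid l)p(l\mid X)\,dl$. A prior is conjugate for a sampling distribution if the posterior belongs to the same parametric family as the prior. A prior is non-informative if its parameters are selected by the principle of maximum entropy for lack of domain knowledge, and a non-informative prior is improper if it fails to be a probability distribution in the limit of entropy maximization.
   Formalization: The middle case of the predictive density has numerator l_n−u_n+w instead of the printed l_n−u_n, which is negative there; the improper prior is obtained by u_0→−∞, l_0→∞, since in the printed directions the interval (u_0−w, l_0) is eventually empty. *)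

theory Defs
  imports "HOL-Probability.Probability"
begin

definition unif :: "real \<Rightarrow> real \<Rightarrow> real \<Rightarrow> real" where
  "unif a b y = (if a < y \<and> y < b then 1 / (b - a) else 0)"

text \<open>
  Bayesian inference for a real parameter \<open>l\<close>. A sampling density \<open>p\<close> is used curried,
  \<open>p l y\<close> standing for the density of an observation \<open>y\<close> given \<open>l\<close>; \<open>\<pi>\<close> is the prior density.
  The data are \<open>x 1, \<dots>, x n\<close>.
\<close>

definition likelihood :: "(real \<Rightarrow> real \<Rightarrow> real) \<Rightarrow> nat \<Rightarrow> (nat \<Rightarrow> real) \<Rightarrow> real \<Rightarrow> real" where
  "likelihood p n x l = (\<Prod>i\<in>{1..n}. p l (x i))"

definition evidence ::
  "(real \<Rightarrow> real \<Rightarrow> real) \<Rightarrow> (real \<Rightarrow> real) \<Rightarrow> nat \<Rightarrow> (nat \<Rightarrow> real) \<Rightarrow> real" where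
  "evidence p \<pi> n x = (LINT l|lborel. likelihood p n x l * \<pi> l)"

definition posterior ::
  "(real \<Rightarrow> real \<Rightarrow> real) \<Rightarrow> (real \<Rightarrow> real) \<Rightarrow> nat \<Rightarrow> (nat \<Rightarrow> real) \<Rightarrow> real \<Rightarrow> real" where
  "posterior p \<pi> n x l = likelihood p n x l * \<pi> l / evidence p \<pi> n x"

definition predictive ::
  "(real \<Rightarrow> real \<Rightarrow> real) \<Rightarrow> (real \<Rightarrow> real) \<Rightarrow> nat \<Rightarrow> (nat \<Rightarrow> real) \<Rightarrow> real \<Rightarrow> real" where
  "predictive p \<pi> n x y = (LINT l|lborel. p l y * posterior p \<pi> n x l)"

text \<open>Data of zero evidence are excluded, since they have no posterior.\<close>

definition conjugate :: "(real \<Rightarrow> real \<Rightarrow> real) \<Rightarrow> (real \<Rightarrow> real) set \<Rightarrow> bool" where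
  "conjugate p F \<longleftrightarrow>
     (\<forall>\<pi>\<in>F. \<forall>n x. evidence p \<pi> n x \<noteq> 0 \<longrightarrow> posterior p \<pi> n x \<in> F)"

definition density_measure :: "(real \<Rightarrow> real) \<Rightarrow> real measure" where
  "density_measure f = density lborel (\<lambda>y. ennreal (f y))"

definition measure_support :: "'a::topological_space measure \<Rightarrow> 'a set" where
  "measure_support M = {y. \<forall>S. open S \<longrightarrow> y \<in> S \<longrightarrow> emeasure M S > 0}"

text \<open>
  The trapezoidal distribution: linear on \<open>[a, b]\<close> and on \<open>[c, d]\<close>, constant on \<open>[b, c]\<close>,
  zero outside \<open>[a, d]\<close>; the height makes the area 1. The triangle \<open>b = c\<close> is allowed.
\<close>

definition trapezoidal :: "real \<Rightarrow> real \<Rightarrow> real \<Rightarrow> real \<Rightarrow> (real \<Rightarrow> real) \<Rightarrow> bool" where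
  "trapezoidal a b c d f \<longleftrightarrow> a < b \<and> b \<le> c \<and> c < d \<and>
     (\<forall>y. f y = 2 / (d + c - a - b) *
        (if a \<le> y \<and> y < b then (y - a) / (b - a)
         else if b \<le> y \<and> y \<le> c then 1
         else if c < y \<and> y \<le> d then (d - y) / (d - c)
         else 0))"

text \<open>Differential entropy, in nats: \<open>- \<integral> f y * ln (f y) dy\<close>.\<close>

definition differential_entropy :: "(real \<Rightarrow> real) \<Rightarrow> real" where
  "differential_entropy f = - KL_divergence (exp 1) lborel (density_measure f)"

text \<open>
  For a family of densities \<open>\<pi> \<theta>\<close> with admissible parameters \<open>\<Theta>\<close>, a filter \<open>L\<close> describes how the
  parameters are moved. Entropy maximization is stated as a limit because the supremum
  need not be attained (nor be finite, hence the extended reals).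
\<close>

definition entropy_maximizing :: "('p \<Rightarrow> real \<Rightarrow> real) \<Rightarrow> 'p set \<Rightarrow> 'p filter \<Rightarrow> bool" where
  "entropy_maximizing \<pi> \<Theta> L \<longleftrightarrow> L \<noteq> bot \<and> (\<forall>\<^sub>F \<theta> in L. \<theta> \<in> \<Theta>) \<and>
     ((\<lambda>\<theta>. ereal (differential_entropy (\<pi> \<theta>))) \<longlongrightarrow>
        (SUP \<theta>\<in>\<Theta>. ereal (differential_entropy (\<pi> \<theta>)))) L"

text \<open>The version of \<^const>\<open>weak_conv_m\<close> for arbitrary filters.\<close>

definition weak_limit :: "('p \<Rightarrow> real measure) \<Rightarrow> real measure \<Rightarrow> 'p filter \<Rightarrow> bool" where
  "weak_limit N M L \<longleftrightarrow> (\<forall>y. isCont (cdf M) y \<longrightarrow> ((\<lambda>\<theta>. cdf (N \<theta>) y) \<longlongrightarrow> cdf M y) L)"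

text \<open>
  Finer filters \<open>L'\<close> are included so that a family merely oscillating between several
  probability distributions does not count as improper.
\<close>

definition noninformative_improper :: "('p \<Rightarrow> real \<Rightarrow> real) \<Rightarrow> 'p set \<Rightarrow> 'p filter \<Rightarrow> bool" where
  "noninformative_improper \<pi> \<Theta> L \<longleftrightarrow> entropy_maximizing \<pi> \<Theta> L \<and>
     (\<forall>L'\<le>L. L' \<noteq> bot \<longrightarrow>
        \<not> (\<exists>M. real_distribution M \<and> weak_limit (\<lambda>\<theta>. density_measure (\<pi> \<theta>)) M L'))"

end

theory Submission
  imports Defs
begin

text \<open>
  As a function of \<open>l\<close>, likelihood times prior is a constant multiple of the indicator of
  \<open>(u_n - w, l_n)\<close>, so normalizing gives a uniform density again, and the predictive density is the
  convolution of two uniform densities, of widths \<open>w\<close> and \<open>l_n - u_n + w\<close>: a trapezoid.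
  The entropy of a uniform density is the logarithm of its width, so it is maximized as the width
  tends to infinity. In that limit every bounded interval loses all its mass, whereas a weak limit
  that is a probability distribution would keep positive mass on some \<open>(y, z]\<close> with \<open>y\<close>, \<open>z\<close>
  continuity points.
\<close>

section \<open>Uniform densities\<close>

lemma unif_eq_indicator: "unif a b y = indicator {a<..<b} y / (b - a)"
  by (simp add: unif_def indicator_def)

lemma borel_measurable_unif [measurable]: "unif a b \<in> borel_measurable borel"
  unfolding unif_eq_indicator by measurable

lemma unif_nonneg: "0 \<le> unif a b y"
  by (simp add: unif_def)

lemma integral_indicator_open_interval:
  fixes a b :: real
  shows "(LINT l|lborel. indicator {a<..<b} l) = max 0 (b - a)"
  by (cases "a \<le> b") auto

section \<open>Evidence, posterior and conjugacy\<close>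

text \<open>All strict lower bounds on \<open>l\<close>, from the data and the prior, merge into one
  maximum, and all upper bounds into one minimum. Inserting \<open>u\<close> and \<open>l0\<close>
  keeps both sets nonempty when \<open>n = 0\<close>.\<close>

lemma likelihood_unif_prior:
  fixes w :: real
  shows "likelihood (\<lambda>l. unif l (l + w)) n x l * unif (u - w) l0 l =
    1 / (w ^ n * (l0 - u + w)) *
    indicator {Max (insert u (x ` {1..n})) - w<..<Min (insert l0 (x ` {1..n}))} l"
proof -
  have "likelihood (\<lambda>l. unif l (l + w)) n x l =
      (\<Prod>i\<in>{1..n}. (if l < x i \<and> x i < l + w then 1 else 0) / w)"
    unfolding likelihood_def by (intro prod.cong) (auto simp: unif_def)
  also have "\<dots> = (if \<forall>i\<in>{1..n}. l < x i \<and> x i < l + w then 1 else 0) / w ^ n"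
    unfolding prod_dividef by auto
  finally have lik: "likelihood (\<lambda>l. unif l (l + w)) n x l =
      (if \<forall>i\<in>{1..n}. l < x i \<and> x i < l + w then 1 else 0) / w ^ n" .
  have "Max (insert u (x ` {1..n})) - w < l \<longleftrightarrow> Max (insert u (x ` {1..n})) < l + w"
    by linarith
  then have Mx: "Max (insert u (x ` {1..n})) - w < l \<longleftrightarrow>
      u < l + w \<and> (\<forall>i\<in>{1..n}. x i < l + w)"
    by (subst (asm) Max_less_iff) auto
  have Mn: "l < Min (insert l0 (x ` {1..n})) \<longleftrightarrow> l < l0 \<and> (\<forall>i\<in>{1..n}. l < x i)"
    by (subst Min_gr_iff) auto
  have "u - w < l \<longleftrightarrow> u < l + w" "l0 - (u - w) = l0 - u + w"
    by auto
  then show ?thesis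
    unfolding lik unif_def indicator_def greaterThanLessThan_iff Mx Mn by auto
qed

lemma evidence_unif:
  fixes w :: real
  shows "evidence (\<lambda>l. unif l (l + w)) (unif (u - w) l0) n x =
    1 / (w ^ n * (l0 - u + w)) *
    max 0 (Min (insert l0 (x ` {1..n})) - Max (insert u (x ` {1..n})) + w)"
proof -
  have "Min A - (Max B - w) = Min A - Max B + w" for A B :: "real set"
    by simp
  then show ?thesis
    unfolding evidence_def likelihood_unif_prior
    by (simp only: integral_mult_right_zero integral_indicator_open_interval)
qed

lemma posterior_unif:
  fixes w :: real
  assumes "w > 0" "u - w < l0"
    and "Max (insert u (x ` {1..n})) - w < Min (insert l0 (x ` {1..n}))"
  shows "posterior (\<lambda>l. unif l (l + w)) (unif (u - w) l0) n x =
    unif (Max (insert u (x ` {1..n})) - w) (Min (insert l0 (x ` {1..n})))"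
proof
  fix l
  \<comment> \<open>\<open>c\<close> stands for \<open>w ^ n * (l0 - u + w)\<close>; it cancels, so
    only the endpoints \<open>U - w\<close> and \<open>M\<close> survive.\<close>
  have cancel: "1 / c * i / (1 / c * max 0 (M - U + w)) = i / (M - (U - w))"
    if "c \<noteq> 0" "U - w < M" for c i M U :: real
  proof -
    have "max 0 (M - U + w) = M - (U - w)"
      using that by simp
    then show ?thesis
      using that(1) by simp
  qed
  show "posterior (\<lambda>l. unif l (l + w)) (unif (u - w) l0) n x l =
      unif (Max (insert u (x ` {1..n})) - w) (Min (insert l0 (x ` {1..n}))) l"
    unfolding posterior_def likelihood_unif_prior evidence_unif
    unfolding unif_eq_indicator by (rule cancel) (use assms in auto)
qed

lemma conjugate_unif:
  fixes w :: real
  assumes "w > 0"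
  shows "conjugate (\<lambda>l. unif l (l + w)) {unif (u - w) l | u l. u - w < l}"
  unfolding conjugate_def
proof (intro ballI allI impI)
  fix \<pi> and n :: nat and x :: "nat \<Rightarrow> real"
  assume "\<pi> \<in> {unif (u - w) l | u l. u - w < l}"
  then obtain u l where pi: "\<pi> = unif (u - w) l" and ul: "u - w < l" by auto
  assume "evidence (\<lambda>l. unif l (l + w)) \<pi> n x \<noteq> 0"
  \<comment> \<open>Nonzero evidence excludes the value 0 of the \<open>max 0\<close> factor, so the
    updated interval is nonempty.\<close>
  then have less: "Max (insert u (x ` {1..n})) - w < Min (insert l (x ` {1..n}))"
    unfolding pi evidence_unif
    by (simp add: max_def del: Max_insert Min_insert Min_gr_iff split: if_splits)
  from posterior_unif[OF assms ul this] less
  show "posterior (\<lambda>l. unif l (l + w)) \<pi> n x \<in> {unif (u - w) l | u l. u - w < l}"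
    unfolding pi by blast
qed

section \<open>Predictive density\<close>

lemma convolution_unif:
  fixes w :: real
  shows "(LINT l|lborel. unif l (l + w) y * unif a b l) =
    max 0 (min b y - max a (y - w)) / (w * (b - a))"
proof -
  \<comment> \<open>\<open>l < y < l + w\<close> puts \<open>l\<close> into the window
    \<open>(y - w, y)\<close>; the integral measures its overlap with \<open>(a, b)\<close>.\<close>
  have "unif l (l + w) y * unif a b l =
      1 / (w * (b - a)) * indicator {max a (y - w)<..<min b y} l" for l
    by (auto simp: unif_def indicator_def)
  then show ?thesis
    by (simp only: integral_mult_right_zero integral_indicator_open_interval) simp
qed

text \<open>As the window \<open>(y - w, y)\<close> slides across \<open>(a, b)\<close>, the overlap
  grows with slope 1, stays constant while the shorter interval lies inside the longer one, and then
  shrinks. The plateau height is \<open>1 / w\<close> if \<open>b \<le> a + w\<close> and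
  \<open>1 / (b - a)\<close> otherwise.\<close>

lemma trapezoidal_convolution_unif:
  fixes w :: real
  assumes "w > 0" "a < b"
  shows "trapezoidal a (min b (a + w)) (max b (a + w)) (b + w)
    (\<lambda>y. max 0 (min b y - max a (y - w)) / (w * (b - a)))"
proof (cases "b \<le> a + w")
  case True
  then have m: "min b (a + w) = b" "max b (a + w) = a + w" by auto
  show ?thesis
    unfolding trapezoidal_def m using True assms
    by (auto simp: max_def min_def divide_simps)
next
  case False
  then have m: "min b (a + w) = a + w" "max b (a + w) = b" by auto
  show ?thesis
    unfolding trapezoidal_def m using False assms
    by (auto simp: max_def min_def divide_simps) (auto simp: algebra_simps)
qed

section \<open>Supports of measures with a density\<close>

lemma not_in_measure_support_density:
  assumes [measurable]: "f \<in> borel_measurable borel"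
    and "open S" "y \<in> S" "\<And>z. z \<in> S \<Longrightarrow> f z = 0"
  shows "y \<notin> measure_support (density_measure f)"
proof -
  have [measurable]: "S \<in> sets borel" using assms by auto
  have "S \<in> null_sets (density_measure f)"
    unfolding density_measure_def by (subst null_sets_density_iff) (auto simp: assms(4))
  then show ?thesis
    using assms by (force simp: measure_support_def)
qed

text \<open>An open null set \<open>S\<close> around \<open>y\<close> would force \<open>f\<close>
  to vanish almost everywhere on it; then the nonempty open set \<open>S \<inter> U\<close> would be
  Lebesgue null.\<close>

lemma in_measure_support_density:
  assumes [measurable]: "f \<in> borel_measurable borel"
    and "open U" "y \<in> U" "\<And>z. z \<in> U \<Longrightarrow> 0 < f z"
  shows "y \<in> measure_support (density_measure f)"
  unfolding measure_support_def
proof (intro CollectI allI impI, rule ccontr)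
  fix S assume S: "open S" "y \<in> S" and "\<not> 0 < emeasure (density_measure f) S"
  then have "S \<in> null_sets (density_measure f)"
    by (simp add: null_sets_def density_measure_def)
  then have "AE z in lborel. z \<in> S \<longrightarrow> ennreal (f z) = 0"
    unfolding density_measure_def by (subst (asm) null_sets_density_iff) auto
  then have "AE z in lborel. z \<notin> S \<inter> U"
    by eventually_elim (use assms(4) in \<open>force simp: ennreal_eq_0_iff\<close>)
  then have "S \<inter> U \<in> null_sets lborel"
    using S assms by (simp add: AE_iff_null_sets)
  then have "negligible (S \<inter> U)"
    using negligible_iff_null_sets null_sets_completionI by blast
  then show False
    using open_not_negligible[of "S \<inter> U"] S assms by blast
qed

section \<open>Entropy\<close>

lemma differential_entropy_unif:
  assumes "a < b"
  shows "differential_entropy (unif a b) = ln (b - a)"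
proof -
  have "differential_entropy (unif a b) = - (LINT y|lborel. unif a b y * ln (unif a b y))"
    unfolding differential_entropy_def density_measure_def
    by (subst lborel.KL_density) (auto simp: unif_nonneg log_def)
  \<comment> \<open>Off the interval the factor \<open>unif a b y\<close> is 0, so the value of
    \<open>ln 0\<close> does not matter.\<close>
  also have "(\<lambda>y. unif a b y * ln (unif a b y)) =
      (\<lambda>y. ln (1 / (b - a)) / (b - a) * indicator {a<..<b} y)"
    by (auto simp: unif_def indicator_def)
  finally show ?thesis
    using assms by (simp add: integral_indicator_open_interval ln_div)
qed

section \<open>Loss of mass as the width grows\<close>

lemma finite_borel_measure_unif:
  "finite_borel_measure (density_measure (unif a b))"
proof -
  have "emeasure (density_measure (unif a b)) UNIV =
      (\<integral>\<^sup>+ y. ennreal (1 / (b - a)) * indicator {a<..<b} y \<partial>lborel)"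
    unfolding density_measure_def
    by (subst emeasure_density) (auto simp: unif_def indicator_def intro!: nn_integral_cong)
  also have "\<dots> = ennreal (1 / (b - a)) * emeasure lborel {a<..<b}"
    by (rule nn_integral_cmult_indicator) auto
  also have "\<dots> < \<infinity>"
    by (cases "a \<le> b") (auto simp: ennreal_mult_less_top)
  finally have "finite_measure (density_measure (unif a b))"
    by (intro finite_measureI) (simp add: density_measure_def)
  then show ?thesis
    by (intro finite_borel_measure.intro finite_borel_measure_axioms.intro)
      (simp_all add: density_measure_def)
qed

text \<open>The density is at most \<open>1 / (b - a)\<close> everywhere, so the mass of
  \<open>{y<..z}\<close> is controlled by the width alone, wherever \<open>(a, b)\<close>
  lies.\<close>

lemma cdf_unif_diff_le:
  assumes "a < b" "y < z"
  shows "cdf (density_measure (unif a b)) z - cdf (density_measure (unif a b)) y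
    \<le> (z - y) / (b - a)"
proof -
  interpret finite_borel_measure "density_measure (unif a b)"
    by (rule finite_borel_measure_unif)
  have "emeasure (density_measure (unif a b)) {y<..z} =
      (\<integral>\<^sup>+ t. ennreal (unif a b t) * indicator {y<..z} t \<partial>lborel)"
    unfolding density_measure_def by (subst emeasure_density) auto
  also have "\<dots> \<le> (\<integral>\<^sup>+ t. ennreal (1 / (b - a)) * indicator {y<..z} t \<partial>lborel)"
    using assms by (intro nn_integral_mono) (auto simp: unif_def indicator_def)
  also have "\<dots> = ennreal (1 / (b - a)) * emeasure lborel {y<..z}"
    by (rule nn_integral_cmult_indicator) auto
  also have "\<dots> = ennreal ((z - y) / (b - a))"
    using assms by (simp flip: ennreal_mult)
  finally have "measure (density_measure (unif a b)) {y<..z} \<le> (z - y) / (b - a)"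
    using assms by (simp add: emeasure_eq_measure)
  then show ?thesis
    using cdf_diff_eq[OF assms(2)] by simp
qed

text \<open>Weak limits control the cdf only at continuity points. A monotone function has countably
  many discontinuities, so suitable points exist in both tails.\<close>

lemma (in real_distribution) obtain_isCont_cdf:
  assumes "\<epsilon> > 0"
  obtains y z where "y < z" "isCont (cdf M) y" "isCont (cdf M) z"
    "cdf M y < \<epsilon>" "1 - \<epsilon> < cdf M z"
proof -
  have c: "countable {y. \<not> isCont (cdf M) y}"
    by (rule mono_ctble_discont) (auto simp: mono_def cdf_nondecreasing)
  have "\<forall>\<^sub>F y in at_bot. cdf M y < \<epsilon>"
    using cdf_lim_at_bot assms by (rule order_tendstoD)
  then obtain B where B: "\<And>y. y \<le> B \<Longrightarrow> cdf M y < \<epsilon>"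
    by (auto simp: eventually_at_bot_linorder)
  have "\<forall>\<^sub>F y in at_top. 1 - \<epsilon> < cdf M y"
    using cdf_lim_at_top_prob by (rule order_tendstoD) (use assms in simp)
  then obtain T where T: "\<And>y. y \<ge> T \<Longrightarrow> 1 - \<epsilon> < cdf M y"
    by (auto simp: eventually_at_top_linorder)
  obtain y where "y \<in> {B - 1<..<B}" "isCont (cdf M) y"
    using real_interval_avoid_countable_set[OF _ c, of "B - 1" B] by auto
  \<comment> \<open>Starting from \<open>max B T\<close> puts \<open>z\<close> above
    \<open>y\<close> as well as into the upper tail.\<close>
  moreover obtain z where "z \<in> {max B T<..<max B T + 1}" "isCont (cdf M) z"
    using real_interval_avoid_countable_set[OF _ c, of "max B T" "max B T + 1"] by auto
  ultimately show ?thesis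
    using B[of y] T[of z] by (intro that[of y z]) auto
qed

lemma not_weak_limit_unif_widening:
  assumes width: "filterlim (\<lambda>\<theta>. b \<theta> - a \<theta>) at_top L" and "L \<noteq> bot"
    and "real_distribution M"
  shows "\<not> weak_limit (\<lambda>\<theta>. density_measure (unif (a \<theta>) (b \<theta>))) M L"
proof
  assume lim: "weak_limit (\<lambda>\<theta>. density_measure (unif (a \<theta>) (b \<theta>))) M L"
  let ?F = "\<lambda>\<theta>. cdf (density_measure (unif (a \<theta>) (b \<theta>)))"
  interpret M: real_distribution M by fact
  \<comment> \<open>The choice 1/2 gives \<open>cdf M y < 1 / 2 < cdf M z\<close>, so
    \<open>{y<..z}\<close> has positive mass under \<open>M\<close>.\<close>
  obtain y z where yz: "y < z" "isCont (cdf M) y" "isCont (cdf M) z"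
    "cdf M y < 1 / 2" "1 - 1 / 2 < cdf M z"
    by (rule M.obtain_isCont_cdf[of "1 / 2"]) auto
  have "((\<lambda>\<theta>. ?F \<theta> z - ?F \<theta> y) \<longlongrightarrow> cdf M z - cdf M y) L"
    using lim yz by (auto simp: weak_limit_def intro!: tendsto_diff)
  moreover have "((\<lambda>\<theta>. (z - y) / (b \<theta> - a \<theta>)) \<longlongrightarrow> 0) L"
    using width by (intro real_tendsto_divide_at_top) auto
  moreover have "\<forall>\<^sub>F \<theta> in L. ?F \<theta> z - ?F \<theta> y \<le> (z - y) / (b \<theta> - a \<theta>)"
    using eventually_gt_at_top[of 0, THEN eventually_compose_filterlim, OF width]
    by eventually_elim (use yz in \<open>auto intro!: cdf_unif_diff_le\<close>)
  ultimately have "cdf M z - cdf M y \<le> 0"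
    using \<open>L \<noteq> bot\<close> by (intro tendsto_le)
  with yz show False by linarith
qed

lemma noninformative_improper_unif:
  fixes a b :: "'p \<Rightarrow> real"
  assumes width: "filterlim (\<lambda>\<theta>. b \<theta> - a \<theta>) at_top L" and "L \<noteq> bot"
  shows "noninformative_improper (\<lambda>\<theta>. unif (a \<theta>) (b \<theta>)) {\<theta>. a \<theta> < b \<theta>} L"
proof -
  let ?H = "\<lambda>\<theta>. ereal (differential_entropy (unif (a \<theta>) (b \<theta>)))"
  let ?\<Theta> = "{\<theta>. a \<theta> < b \<theta>}"
  have ev: "\<forall>\<^sub>F \<theta> in L. \<theta> \<in> ?\<Theta>"
    using eventually_gt_at_top[of 0, THEN eventually_compose_filterlim, OF width] by simp
  have "filterlim (\<lambda>\<theta>. ln (b \<theta> - a \<theta>)) at_top L"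
    by (rule filterlim_compose[OF ln_at_top width])
  then have "((\<lambda>\<theta>. ereal (ln (b \<theta> - a \<theta>))) \<longlongrightarrow> \<infinity>) L"
    by (simp add: tendsto_PInfty_eq_at_top)
  moreover have "\<forall>\<^sub>F \<theta> in L. ereal (ln (b \<theta> - a \<theta>)) = ?H \<theta>"
    using ev by eventually_elim (simp add: differential_entropy_unif)
  ultimately have H: "(?H \<longlongrightarrow> \<infinity>) L"
    by (rule Lim_transform_eventually)
  \<comment> \<open>The parameters are eventually admissible, so the limit of the entropies is
    bounded by their supremum; an infinite limit makes the supremum infinite.\<close>
  have "\<infinity> \<le> (SUP \<theta>\<in>?\<Theta>. ?H \<theta>)"
    using ev by (intro tendsto_upperbound[OF H _ \<open>L \<noteq> bot\<close>])
      (auto elim!: eventually_mono intro!: SUP_upper)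
  then have "(SUP \<theta>\<in>?\<Theta>. ?H \<theta>) = \<infinity>"
    by simp
  with H ev \<open>L \<noteq> bot\<close> have "entropy_maximizing (\<lambda>\<theta>. unif (a \<theta>) (b \<theta>)) ?\<Theta> L"
    by (simp add: entropy_maximizing_def)
  then show ?thesis
    \<comment> \<open>A finer filter \<open>L'\<close> inherits the divergence of the width, so it
      too admits no probability distribution as weak limit.\<close>
    unfolding noninformative_improper_def
    using not_weak_limit_unif_widening filterlim_mono[OF width order_refl] by blast
qed

text \<open>For \<open>l_n < y < u_n\<close> the whole posterior interval lies in
  \<open>(y - w, y)\<close>, so the numerator is its full width \<open>l_n - u_n + w\<close> and the
  density is \<open>1 / w\<close>; \<open>l_n - u_n\<close> would be negative there. The prior has
  width \<open>l0 - u0 + w\<close>, so the improper limit sends \<open>u0\<close> to minus infinity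
  and \<open>l0\<close> to plus infinity; in the opposite direction the parameters leave the
  admissible set.\<close>

theorem mainTheorem6:
  fixes w u0 l0 u_n l_n :: real and n :: nat and x :: "nat \<Rightarrow> real"
    and p :: "real \<Rightarrow> real \<Rightarrow> real" and \<pi> :: "real \<Rightarrow> real"
  assumes "w > 0"
    and "u0 - w < l0"
    and p: "p = (\<lambda>l. unif l (l + w))"
    and prior: "\<pi> = unif (u0 - w) l0"
    and u_n: "u_n = Max (insert u0 (x ` {1..n}))"
    and l_n: "l_n = Min (insert l0 (x ` {1..n}))"
    and "u_n - w < l_n"
  shows
    "evidence p \<pi> n x = (1 / w ^ n) * ((l_n - u_n + w) / (l0 - u0 + w))
     \<and> (\<forall>l. posterior p \<pi> n x l = unif (u_n - w) l_n l)
     \<and> (\<forall>l. u_n - w < l \<and> l < l_n \<longrightarrow> posterior p \<pi> n x l = 1 / (l_n - u_n + w))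
     \<and> conjugate p {unif (u - w) l | u l. u - w < l}
     \<and> (\<forall>y. max l_n u_n < y \<and> y < l_n + w \<longrightarrow>
          predictive p \<pi> n x y = (l_n - y + w) / (w * (l_n - u_n + w)))
     \<and> (\<forall>y. l_n < y \<and> y < u_n \<longrightarrow>
          predictive p \<pi> n x y = (l_n - u_n + w) / (w * (l_n - u_n + w)))
     \<and> (\<forall>y. u_n - w < y \<and> y < min l_n u_n \<longrightarrow>
          predictive p \<pi> n x y = (y - u_n + w) / (w * (l_n - u_n + w)))
     \<and> trapezoidal (u_n - w) (min l_n u_n) (max l_n u_n) (l_n + w) (predictive p \<pi> n x)
     \<and> measure_support (density_measure (unif l_n u_n))
         \<subset> measure_support (density_measure (predictive p \<pi> n x))
     \<and> noninformative_improper (\<lambda>(u, l). unif (u - w) l) {(u, l). u - w < l}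
         (at_bot \<times>\<^sub>F at_top)"
proof -
  note w = assms(1) and less = assms(7)
  have ev: "evidence p \<pi> n x = (1 / w ^ n) * ((l_n - u_n + w) / (l0 - u0 + w))"
    using less w unfolding p prior evidence_unif u_n[symmetric] l_n[symmetric] by simp
  have post: "posterior p \<pi> n x = unif (u_n - w) l_n"
    using posterior_unif[OF w assms(2)] less unfolding p prior u_n l_n by simp
  have "l_n - (u_n - w) = l_n - u_n + w" by simp
  then have post': "posterior p \<pi> n x l = 1 / (l_n - u_n + w)" if "u_n - w < l" "l < l_n" for l
    using that unfolding post unif_def by simp
  \<comment> \<open>The overlap formula is used with \<open>a = u_n - w\<close> and
    \<open>b = l_n\<close>; then \<open>a + w = u_n\<close>, and the inner corners of the trapezoid
    are \<open>l_n\<close> and \<open>u_n\<close>.\<close>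
  have pred: "predictive p \<pi> n x =
      (\<lambda>y. max 0 (min l_n y - max (u_n - w) (y - w)) / (w * (l_n - u_n + w)))"
    unfolding predictive_def post unfolding p convolution_unif by (simp add: algebra_simps)
  have upper: "predictive p \<pi> n x y = (l_n - y + w) / (w * (l_n - u_n + w))"
    if "max l_n u_n < y" "y < l_n + w" for y
    using that less w by (simp add: pred)
  have middle: "predictive p \<pi> n x y = (l_n - u_n + w) / (w * (l_n - u_n + w))"
    if "l_n < y" "y < u_n" for y
    using that less w by (simp add: pred divide_simps)
  have lower: "predictive p \<pi> n x y = (y - u_n + w) / (w * (l_n - u_n + w))"
    if "u_n - w < y" "y < min l_n u_n" for y
    using that less w by (simp add: pred)
  have trap: "trapezoidal (u_n - w) (min l_n u_n) (max l_n u_n) (l_n + w) (predictive p \<pi> n x)"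
    using trapezoidal_convolution_unif[OF w less] unfolding pred
    by (simp add: algebra_simps)
  have meas: "predictive p \<pi> n x \<in> borel_measurable borel"
    unfolding pred by measurable
  have "{u_n - w<..<l_n + w} \<subseteq> measure_support (density_measure (predictive p \<pi> n x))"
    by (intro subsetI in_measure_support_density[OF meas, of "{u_n - w<..<l_n + w}"])
      (use less w in
        \<open>auto simp: pred max_def min_def intro!: divide_pos_pos mult_pos_pos\<close>)
  \<comment> \<open>If \<open>u_n < l_n\<close>, then \<open>{l_n..u_n}\<close> is empty and
    \<open>unif l_n u_n\<close> vanishes, so the support is empty too.\<close>
  moreover have "y \<notin> measure_support (density_measure (unif l_n u_n))" if "y \<notin> {l_n..u_n}" for y
    using that by (intro not_in_measure_support_density[of _ "- {l_n..u_n}"]) (auto simp: unif_def)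
  \<comment> \<open>Strictness: the midpoint of the posterior interval lies below
    \<open>l_n\<close>, hence outside \<open>{l_n..u_n}\<close>.\<close>
  moreover have "(u_n - w + l_n) / 2 \<in> {u_n - w<..<l_n + w} - {l_n..u_n}"
    using less w by (auto simp: field_simps)
  moreover have "{l_n..u_n} \<subseteq> {u_n - w<..<l_n + w}"
    using less w by auto
  ultimately have supp: "measure_support (density_measure (unif l_n u_n))
      \<subset> measure_support (density_measure (predictive p \<pi> n x))"
    by blast
  \<comment> \<open>The width equals \<open>w + (- u + l)\<close>, and both \<open>- u\<close> and
    \<open>l\<close> tend to infinity.\<close>
  have "filterlim (\<lambda>\<theta>. snd \<theta> - (fst \<theta> - w)) at_top (at_bot \<times>\<^sub>F at_top)"
  proof -
    have "filterlim (\<lambda>\<theta>. - fst \<theta> + snd \<theta>) at_top (at_bot \<times>\<^sub>F at_top :: (real \<times> real) filter)"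
      by (intro filterlim_at_top_add_at_top filterlim_snd)
        (rule filterlim_compose[OF filterlim_uminus_at_top_at_bot filterlim_fst])
    then have "filterlim (\<lambda>\<theta>. w + (- fst \<theta> + snd \<theta>)) at_top
        (at_bot \<times>\<^sub>F at_top :: (real \<times> real) filter)"
      by (rule filterlim_tendsto_add_at_top[OF tendsto_const])
    then show ?thesis by (simp add: algebra_simps)
  qed
  then have "noninformative_improper (\<lambda>\<theta>. unif (fst \<theta> - w) (snd \<theta>)) {\<theta>. fst \<theta> - w < snd \<theta>}
      (at_bot \<times>\<^sub>F at_top)"
    by (rule noninformative_improper_unif) (simp add: prod_filter_eq_bot)
  then have improper: "noninformative_improper (\<lambda>(u, l). unif (u - w) l) {(u, l). u - w < l}
      (at_bot \<times>\<^sub>F at_top)"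
    by (simp add: case_prod_unfold)
  show ?thesis
    using ev post post' conjugate_unif[OF w] upper middle lower trap supp improper
    unfolding p by auto
qed

end
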